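(* There is an absolute constant $C$ such that for every positive integer $r$ and every $m$ for which a $\mathrm{DD}(m,r)$ exists, \[ m\leq \tfrac{\sqrt{\pi}}{2}\,r+\tfrac{3\,\pi^{1/3}}{2^{5/3}}\,r^{2/3}+C\,r^{1/3}. \]
   Context: The square grid is $\mathbb{Z}^2\subset\mathbb{R}^2$. A $\mathrm{DD}(m,r)$ (Euclidean square distinct difference configuration) is a set of $m$ points ("dots") of $\mathbb{Z}^2$ such that (1) any two dots are at Euclidean distance at most $r$, and (2) the lines joining pairs of dots are pairwise distinct either in length or in slope; equivalently, the vectors $a-b$, over ordered pairs $(a,b)$ of distinct dots, are pairwise distinct. *)

theory Defs
  imports "HOL-Analysis.Analysis"
begin

definition emb :: "int \<times> int \<Rightarrow> real \<times> real" where
  "emb p = (real_of_int (fst p), real_of_int (snd p))"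

text \<open>The metric on \<^typ>\<open>real \<times> real\<close> is the Euclidean one.\<close>

definition seg_length :: "int \<times> int \<Rightarrow> int \<times> int \<Rightarrow> real" where
  "seg_length a b = dist (emb a) (emb b)"

text \<open>\<^term>\<open>None\<close> is the slope of a vertical line.\<close>

definition seg_slope :: "int \<times> int \<Rightarrow> int \<times> int \<Rightarrow> real option" where
  "seg_slope a b =
     (if fst a = fst b then None
      else Some (real_of_int (snd b - snd a) / real_of_int (fst b - fst a)))"

text \<open>The last condition ranges over distinct unordered pairs of distinct dots.\<close>

definition is_DD :: "nat \<Rightarrow> nat \<Rightarrow> (int \<times> int) set \<Rightarrow> bool" where
  "is_DD m r D \<longleftrightarrow>
     finite D \<and> card D = m \<and>
     (\<forall>a\<in>D. \<forall>b\<in>D. seg_length a b \<le> real r) \<and>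
     (\<forall>a\<in>D. \<forall>b\<in>D. \<forall>c\<in>D. \<forall>d\<in>D.
        a \<noteq> b \<and> c \<noteq> d \<and> {a, b} \<noteq> {c, d} \<longrightarrow>
        seg_length a b \<noteq> seg_length c d \<or> seg_slope a b \<noteq> seg_slope c d)"

lemma seg_length_alt:
  "seg_length a b = sqrt (real_of_int ((fst b - fst a)\<^sup>2 + (snd b - snd a)\<^sup>2))"
  by (simp add: seg_length_def emb_def dist_prod_def dist_real_def power2_commute)

lemma same_length_slope_iff:
  "seg_length a b = seg_length c d \<and> seg_slope a b = seg_slope c d
    \<longleftrightarrow> b - a = d - c \<or> b - a = c - d"
proof -
  define x y u v where "x = fst b - fst a" and "y = snd b - snd a"
    and "u = fst d - fst c" and "v = snd d - snd c"
  have L: "seg_length a b = seg_length c d \<longleftrightarrow> x\<^sup>2 + y\<^sup>2 = u\<^sup>2 + v\<^sup>2"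
    unfolding seg_length_alt x_def y_def u_def v_def real_sqrt_eq_iff of_int_eq_iff ..
  have S: "seg_slope a b = seg_slope c d \<longleftrightarrow>
      (x = 0 \<and> u = 0) \<or> (x \<noteq> 0 \<and> u \<noteq> 0 \<and> y * u = v * x)"
  proof -
    have "seg_slope a b = (if x = 0 then None else Some (real_of_int y / real_of_int x))"
      "seg_slope c d = (if u = 0 then None else Some (real_of_int v / real_of_int u))"
      by (simp_all add: seg_slope_def x_def y_def u_def v_def)
    moreover have "real_of_int y / real_of_int x = real_of_int v / real_of_int u \<longleftrightarrow> y * u = v * x"
      if "x \<noteq> 0" "u \<noteq> 0"
      using that by (simp add: frac_eq_eq flip: of_int_mult)
    ultimately show ?thesis by simp
  qed
  have R: "b - a = d - c \<longleftrightarrow> x = u \<and> y = v" "b - a = c - d \<longleftrightarrow> x = - u \<and> y = - v"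
    by (auto simp: prod_eq_iff x_def y_def u_def v_def)
  have key: "x = u \<and> y = v \<or> x = - u \<and> y = - v"
    if e: "x\<^sup>2 + y\<^sup>2 = u\<^sup>2 + v\<^sup>2" and "x \<noteq> 0" and "u \<noteq> 0" and p: "y * u = v * x"
  proof -
    have "x\<^sup>2 * (u\<^sup>2 + v\<^sup>2) = u\<^sup>2 * (x\<^sup>2 + y\<^sup>2)"
      using arg_cong[OF p, of "\<lambda>t. t\<^sup>2"] by (simp add: algebra_simps)
    moreover have "u\<^sup>2 + v\<^sup>2 \<noteq> 0"
      using \<open>u \<noteq> 0\<close> by simp
    ultimately have "x\<^sup>2 = u\<^sup>2" using e by (metis mult_right_cancel)
    then have "x = u \<or> x = - u" by (simp add: power2_eq_iff)
    then show ?thesis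
    proof
      assume "x = u"
      then show ?thesis using p \<open>u \<noteq> 0\<close> by simp
    next
      assume x: "x = - u"
      then have "y * u = - v * u" using p by simp
      then have "y = - v" using \<open>u \<noteq> 0\<close> mult_right_cancel by blast
      then show ?thesis using x by simp
    qed
  qed
  show ?thesis
    unfolding L S R
  proof
    assume h: "x\<^sup>2 + y\<^sup>2 = u\<^sup>2 + v\<^sup>2 \<and>
      (x = 0 \<and> u = 0 \<or> x \<noteq> 0 \<and> u \<noteq> 0 \<and> y * u = v * x)"
    show "x = u \<and> y = v \<or> x = - u \<and> y = - v"
    proof (cases "x = 0")
      case True
      then have "u = 0" "y\<^sup>2 = v\<^sup>2" using h by auto
      then show ?thesis using True by (auto simp: power2_eq_iff)
    next
      case False
      then show ?thesis using h key by blast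
    qed
  next
    assume h: "x = u \<and> y = v \<or> x = - u \<and> y = - v"
    show "x\<^sup>2 + y\<^sup>2 = u\<^sup>2 + v\<^sup>2 \<and>
      (x = 0 \<and> u = 0 \<or> x \<noteq> 0 \<and> u \<noteq> 0 \<and> y * u = v * x)"
      using h
    proof
      assume "x = u \<and> y = v"
      then show ?thesis by simp
    next
      assume "x = - u \<and> y = - v"
      then show ?thesis by simp
    qed
  qed
qed

lemma is_DD_iff_differences:
  "is_DD m r D \<longleftrightarrow>
     finite D \<and> card D = m \<and>
     (\<forall>a\<in>D. \<forall>b\<in>D. seg_length a b \<le> real r) \<and>
     inj_on (\<lambda>(a, b). a - b) {(a, b). a \<in> D \<and> b \<in> D \<and> a \<noteq> b}"
proof -
  have "(\<forall>a\<in>D. \<forall>b\<in>D. \<forall>c\<in>D. \<forall>d\<in>D.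
        a \<noteq> b \<and> c \<noteq> d \<and> {a, b} \<noteq> {c, d} \<longrightarrow>
        seg_length a b \<noteq> seg_length c d \<or> seg_slope a b \<noteq> seg_slope c d)
     \<longleftrightarrow> (\<forall>a\<in>D. \<forall>b\<in>D. \<forall>c\<in>D. \<forall>d\<in>D. a \<noteq> b \<and> c \<noteq> d \<and> a - b = c - d \<longrightarrow> a = c \<and> b = d)"
    (is "?P \<longleftrightarrow> ?Q")
  proof
    assume P: ?P
    show ?Q
    proof (intro ballI impI)
      fix a b c d assume D: "a \<in> D" "b \<in> D" "c \<in> D" "d \<in> D"
        and h: "a \<noteq> b \<and> c \<noteq> d \<and> a - b = c - d"
      have "b - a = d - c" using h by (metis minus_diff_eq)
      then have "seg_length a b = seg_length c d \<and> seg_slope a b = seg_slope c d"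
        using same_length_slope_iff[of a b c d] by simp
      then have "{a, b} = {c, d}" using P D h by metis
      moreover have "\<not> (a = d \<and> b = c)"
      proof
        assume "a = d \<and> b = c"
        then have "a - b = b - a" using h by simp
        then have "a = b" by (auto simp: prod_eq_iff)
        then show False using h by simp
      qed
      ultimately show "a = c \<and> b = d" by (auto simp: doubleton_eq_iff)
    qed
  next
    assume Q: ?Q
    show ?P
    proof (intro ballI impI)
      fix a b c d assume D: "a \<in> D" "b \<in> D" "c \<in> D" "d \<in> D"
        and h: "a \<noteq> b \<and> c \<noteq> d \<and> {a, b} \<noteq> {c, d}"
      have "b - a \<noteq> d - c" "b - a \<noteq> c - d"
      proof -
        show "b - a \<noteq> d - c"
        proof
          assume "b - a = d - c"
          then have "b = d \<and> a = c" using Q D h by metis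
          then show False using h by simp
        qed
        show "b - a \<noteq> c - d"
        proof
          assume "b - a = c - d"
          then have "b = c \<and> a = d" using Q D h by metis
          then show False using h by auto
        qed
      qed
      then show "seg_length a b \<noteq> seg_length c d \<or> seg_slope a b \<noteq> seg_slope c d"
        using same_length_slope_iff[of a b c d] by blast
    qed
  qed
  moreover have "?Q \<longleftrightarrow> inj_on (\<lambda>(a, b). a - b) {(a, b). a \<in> D \<and> b \<in> D \<and> a \<noteq> b}"
    unfolding inj_on_def Ball_def split_paired_All mem_Collect_eq split_conv prod.inject by meson
  ultimately show ?thesis unfolding is_DD_def by (simp only:)
qed

end

theory Submission imports Defs begin

text \<open>
  Count the dots in the translates, by lattice vectors, of the lattice disc of radius \<open>l\<close>, which has
  \<open>N \<approx> \<pi> l\<^sup>2\<close> points. The centres of the translates that meet the configuration form a lattice set of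
  diameter at most \<open>r + 2 l\<close>, so by the isodiametric inequality there are
  \<open>M \<lesssim> \<pi> (r + 2 l)\<^sup>2 / 4\<close> of them. Since differences are distinct, the number of ordered pairs of
  distinct dots, summed over all translates, is at most \<open>N\<^sup>2\<close>, and Cauchy--Schwarz gives
  \<open>m\<^sup>2 \<le> M (1 + m / N)\<close>. The choice \<open>l\<^sup>3 = r\<^sup>2 / (4 \<surd>\<pi>)\<close> minimises the resulting bound.
\<close>

section \<open>Steiner symmetrization and the isodiametric inequality in the plane\<close>

lemma sets_lborel_pair:
  fixes A :: "(real \<times> real) set"
  shows "A \<in> sets (lborel \<Otimes>\<^sub>M lborel) \<longleftrightarrow> A \<in> sets borel"
  unfolding lborel_prod by simp

text \<open>Steiner symmetrization about the horizontal axis: each vertical section becomes the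
  centred open interval of the same length. The strict inequality makes null sections empty and
  sections of infinite measure the whole line.\<close>

definition steiner :: "(real \<times> real) set \<Rightarrow> (real \<times> real) set" where
  "steiner A = {(x, y). ennreal (2 * \<bar>y\<bar>) < emeasure lborel (Pair x -` A)}"

lemma steiner_borel:
  assumes "A \<in> sets borel"
  shows "steiner A \<in> sets borel"
proof -
  have A: "A \<in> sets (lborel \<Otimes>\<^sub>M lborel)"
    using assms unfolding sets_lborel_pair .
  have [measurable]: "(\<lambda>x. emeasure lborel (Pair x -` A)) \<in> borel_measurable (lborel :: real measure)"
    by (rule lborel.measurable_emeasure_Pair[OF A])
  have "{z \<in> space (lborel \<Otimes>\<^sub>M lborel). ennreal (2 * \<bar>snd z\<bar>) < emeasure lborel (Pair (fst z) -` A)}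
      \<in> sets (lborel \<Otimes>\<^sub>M lborel)"
    by measurable
  then show ?thesis
    unfolding sets_lborel_pair by (simp add: steiner_def space_pair_measure case_prod_unfold)
qed

lemma emeasure_symmetric_interval:
  "emeasure lborel {y::real. ennreal (2 * \<bar>y\<bar>) < c} = c"
proof (cases c)
  case (real a)
  have "{y::real. ennreal (2 * \<bar>y\<bar>) < c} = {- a / 2 <..< a / 2}"
    using real by (auto simp: ennreal_less_iff)
  then show ?thesis using real by simp
qed simp

lemma emeasure_steiner:
  assumes "A \<in> sets borel"
  shows "emeasure lborel (steiner A) = emeasure lborel A"
proof -
  have fubini: "emeasure lborel B = (\<integral>\<^sup>+ x. emeasure lborel (Pair x -` B) \<partial>lborel)"
    if "B \<in> sets borel" for B :: "(real \<times> real) set"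
    using lborel.emeasure_pair_measure_alt[of B "lborel :: real measure"] that
    unfolding sets_lborel_pair by (simp add: lborel_prod)
  have "Pair x -` steiner A = {y. ennreal (2 * \<bar>y\<bar>) < emeasure lborel (Pair x -` A)}" for x
    by (auto simp: steiner_def)
  then show ?thesis
    by (simp add: fubini[OF assms] fubini[OF steiner_borel[OF assms]] emeasure_symmetric_interval)
qed

text \<open>If \<open>i\<close> and \<open>s\<close> are the infimum and supremum of
  \<open>Y\<close>, then \<open>X\<close> is confined to the interval from \<open>s - c\<close> to
  \<open>i + c\<close>, so the two enclosing lengths add up to exactly \<open>2 * c\<close>.\<close>

lemma emeasure_add_le_of_cross_distance:
  fixes X Y :: "real set"
  assumes "X \<noteq> {}" "Y \<noteq> {}" "\<And>u v. u \<in> X \<Longrightarrow> v \<in> Y \<Longrightarrow> \<bar>u - v\<bar> \<le> c"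
  shows "emeasure lborel X + emeasure lborel Y \<le> ennreal (2 * c)"
proof -
  obtain u0 v0 where u0: "u0 \<in> X" and v0: "v0 \<in> Y" using assms by blast
  have b: "u \<le> v + c" "v \<le> u + c" if "u \<in> X" "v \<in> Y" for u v
    using assms(3)[OF that] by auto
  have Yb: "bdd_above Y" "bdd_below Y"
    using b[OF u0] by (auto intro!: bdd_aboveI[of _ "u0 + c"] bdd_belowI[of _ "u0 - c"] simp: algebra_simps)
  define s i where "s = Sup Y" and "i = Inf Y"
  have "i \<le> v0" "v0 \<le> s" using Yb v0 by (auto simp: s_def i_def cSup_upper cInf_lower)
  have Y: "Y \<subseteq> {i..s}" using Yb by (auto simp: s_def i_def cSup_upper cInf_lower)
  have "s - c \<le> u" if "u \<in> X" for u
    using cSup_least[OF assms(2), of "u + c"] b[OF that] by (auto simp: s_def)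
  moreover have "u \<le> i + c" if "u \<in> X" for u
    using cInf_greatest[OF assms(2), of "u - c"] b[OF that] by (force simp: i_def)
  ultimately have X: "X \<subseteq> {s - c..i + c}" by auto
  have "s - c \<le> i + c" using X u0 by fastforce
  have "emeasure lborel X + emeasure lborel Y \<le> emeasure lborel {s - c..i + c} + emeasure lborel {i..s}"
    using X Y by (intro add_mono emeasure_mono) auto
  also have "\<dots> = ennreal (2 * c)"
    using \<open>s - c \<le> i + c\<close> \<open>i \<le> v0\<close> \<open>v0 \<le> s\<close> by (simp flip: ennreal_plus)
  finally show ?thesis .
qed

text \<open>Symmetrization does not enlarge the diameter: the sections over \<open>x\<close> and
  \<open>x'\<close> are long enough to contain points at least as far apart vertically as
  \<open>y\<close> and \<open>y'\<close>, and the horizontal separation is unchanged.\<close>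

lemma dist_steiner_le:
  assumes A: "\<And>p q. p \<in> A \<Longrightarrow> q \<in> A \<Longrightarrow> dist p q \<le> d"
    and p: "p \<in> steiner A" and q: "q \<in> steiner A"
  shows "dist p q \<le> d"
proof -
  obtain x y x' y' where pq: "p = (x, y)" "q = (x', y')" by fastforce
  define X Y where "X = Pair x -` A" and "Y = Pair x' -` A"
  have m: "ennreal (2 * \<bar>y\<bar>) < emeasure lborel X" "ennreal (2 * \<bar>y'\<bar>) < emeasure lborel Y"
    using p q by (auto simp: pq steiner_def X_def Y_def)
  have ne: "X \<noteq> {}" "Y \<noteq> {}" using m by auto
  have "\<exists>u\<in>X. \<exists>v\<in>Y. \<bar>y - y'\<bar> \<le> \<bar>u - v\<bar>"
  proof (rule ccontr)
    assume "\<not> ?thesis"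
    then have "emeasure lborel X + emeasure lborel Y \<le> ennreal (2 * \<bar>y - y'\<bar>)"
      by (intro emeasure_add_le_of_cross_distance ne) force
    also have "\<dots> \<le> ennreal (2 * \<bar>y\<bar> + 2 * \<bar>y'\<bar>)"
      using abs_triangle_ineq4[of y y'] by (intro ennreal_leI) simp
    also have "\<dots> = ennreal (2 * \<bar>y\<bar>) + ennreal (2 * \<bar>y'\<bar>)" by (rule ennreal_plus) auto
    also have "\<dots> < emeasure lborel X + emeasure lborel Y"
      using m by (rule add_strict_mono)
    finally show False by simp
  qed
  then obtain u v where uv: "(x, u) \<in> A" "(x', v) \<in> A" "\<bar>y - y'\<bar> \<le> \<bar>u - v\<bar>"
    by (auto simp: X_def Y_def)
  have "dist p q \<le> dist (x, u) (x', v)"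
    using uv(3) by (auto simp: pq dist_prod_def dist_real_def abs_le_square_iff)
  also have "\<dots> \<le> d" using uv A by blast
  finally show ?thesis .
qed

text \<open>Symmetrizing in both coordinate directions yields a centrally symmetric set, and such a set
  of diameter at most \<open>d\<close> lies in the ball of radius \<open>d / 2\<close>.\<close>

theorem isodiametric:
  fixes A :: "(real \<times> real) set"
  assumes A: "A \<in> sets borel" and d: "\<And>p q. p \<in> A \<Longrightarrow> q \<in> A \<Longrightarrow> dist p q \<le> d" and "0 \<le> d"
  shows "emeasure lborel A \<le> ennreal (pi / 4 * d\<^sup>2)"
proof -
  \<comment> \<open>The swap makes the second application of \<open>steiner\<close> act in the other
    coordinate direction.\<close>
  define S where "S = prod.swap -` steiner A"
  define T where "T = steiner S"
  have swap: "(\<lambda>(x, y). (y, x)) = (prod.swap :: real \<times> real \<Rightarrow> _)"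
    by auto
  have meas: "prod.swap \<in> (lborel \<Otimes>\<^sub>M lborel :: (real \<times> real) measure)
      \<rightarrow>\<^sub>M (lborel \<Otimes>\<^sub>M lborel :: (real \<times> real) measure)"
    using measurable_pair_swap'[of "lborel :: real measure" "lborel :: real measure"] by (simp add: swap)
  have st: "steiner A \<in> sets (lborel \<Otimes>\<^sub>M lborel)"
    using steiner_borel[OF A] unfolding sets_lborel_pair .
  have S: "S \<in> sets borel"
    using measurable_sets[OF meas st] unfolding sets_lborel_pair by (simp add: S_def space_pair_measure)
  have "emeasure lborel (steiner A)
      = emeasure (distr (lborel \<Otimes>\<^sub>M lborel) (lborel \<Otimes>\<^sub>M lborel) prod.swap) (steiner A)"
    using lborel_pair.distr_pair_swap[where ?'a = real and ?'b = real] by (simp add: swap lborel_prod)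
  also have "\<dots> = emeasure lborel S"
    using emeasure_distr[OF meas st] by (simp add: S_def lborel_prod space_pair_measure)
  finally have "emeasure lborel A = emeasure lborel T"
    using emeasure_steiner[OF A] emeasure_steiner[OF S] by (simp add: T_def)
  also have "\<dots> \<le> emeasure lborel (cball (0 :: real \<times> real) (d / 2))"
  proof (rule emeasure_mono)
    show "T \<subseteq> cball 0 (d / 2)"
    proof
      fix p assume p: "p \<in> T"
      have S_d: "dist a b \<le> d" if "a \<in> S" "b \<in> S" for a b
      proof -
        have "dist (prod.swap a) (prod.swap b) \<le> d"
          using that dist_steiner_le[OF d] by (auto simp: S_def)
        then show ?thesis by (simp add: dist_prod_def add.commute)
      qed
      \<comment> \<open>The second symmetrization keeps the symmetry created by the first: opposite
        sections of \<open>S\<close> coincide, so \<open>T\<close> is symmetric in both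
        coordinates.\<close>
      have "- p \<in> T"
      proof -
        have "Pair (- x) -` S = Pair x -` S" for x
          by (auto simp: S_def steiner_def)
        then show ?thesis using p by (auto simp: T_def steiner_def)
      qed
      then have "dist p (- p) \<le> d"
        using dist_steiner_le[of S d p "- p", OF S_d] p by (simp add: T_def)
      moreover have "dist p (- p) = 2 * norm p"
        by (simp add: dist_norm flip: scaleR_2)
      ultimately show "p \<in> cball 0 (d / 2)" by simp
    qed
  qed simp
  also have "\<dots> = ennreal (pi / 4 * d\<^sup>2)"
    using emeasure_cball[of "d / 2" "0 :: real \<times> real"] \<open>0 \<le> d\<close>
    by (simp add: unit_ball_vol_2 power2_eq_square mult_ac flip: ennreal_mult')
  finally show ?thesis .
qed

section \<open>Lattice point counts as areas of unit cells\<close>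

text \<open>The union of the unit squares with lower left corners in \<open>E\<close>. Half-open
  squares are disjoint, so area counts lattice points exactly.\<close>

definition cells :: "(int \<times> int) set \<Rightarrow> (real \<times> real) set" where
  "cells E = {z. (\<lfloor>fst z\<rfloor>, \<lfloor>snd z\<rfloor>) \<in> E}"

lemma cells_singleton:
  "cells {p} = {of_int (fst p)..<of_int (fst p) + 1} \<times> {of_int (snd p)..<of_int (snd p) + 1}"
  by (auto simp: cells_def floor_eq_iff prod_eq_iff)

lemma cells_UN: "cells E = (\<Union>p\<in>E. cells {p})"
  by (auto simp: cells_def)

lemma cells_singleton_borel: "cells {p} \<in> sets borel"
proof -
  have "cells {p} \<in> sets (lborel \<Otimes>\<^sub>M lborel)"
    unfolding cells_singleton by (intro pair_measureI) auto
  then show ?thesis unfolding sets_lborel_pair .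
qed

lemma cells_borel: "finite E \<Longrightarrow> cells E \<in> sets borel"
  by (subst cells_UN) (auto intro: cells_singleton_borel)

lemma emeasure_cells:
  assumes "finite E"
  shows "emeasure lborel (cells E) = of_nat (card E)"
proof -
  have "emeasure lborel (cells {p}) = 1" for p
    unfolding cells_singleton
    by (subst lborel_prod[symmetric], subst lborel.emeasure_pair_measure_Times) auto
  moreover have "emeasure lborel (\<Union>p\<in>E. cells {p}) = (\<Sum>p\<in>E. emeasure lborel (cells {p}))"
    using assms cells_singleton_borel
    by (intro sum_emeasure[symmetric]) (auto simp: disjoint_family_on_def cells_def)
  ultimately show ?thesis by (subst cells_UN) simp
qed

text \<open>The bound 2 instead of \<open>sqrt 2\<close> is harmless: it changes radii and diameters
  only by a bounded amount, which the error term absorbs.\<close>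

lemma norm_le_2_of_coordinates_le_1:
  fixes h :: "real \<times> real"
  assumes "\<bar>fst h\<bar> \<le> 1" "\<bar>snd h\<bar> \<le> 1"
  shows "norm h \<le> 2"
  using norm_Pair_le[of "fst h" "snd h"] assms by simp

lemma dist_emb_floor_le:
  fixes z w :: "real \<times> real"
  shows "dist z w \<le> dist (emb (\<lfloor>fst z\<rfloor>, \<lfloor>snd z\<rfloor>)) (emb (\<lfloor>fst w\<rfloor>, \<lfloor>snd w\<rfloor>)) + 2"
proof -
  let ?f = "\<lambda>z. (\<lfloor>fst z\<rfloor>, \<lfloor>snd z\<rfloor>) :: int \<times> int"
  have "norm ((z - emb (?f z)) - (w - emb (?f w))) \<le> 2"
    by (rule norm_le_2_of_coordinates_le_1; simp add: emb_def; linarith)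
  moreover have "z - w = ((z - emb (?f z)) - (w - emb (?f w))) + (emb (?f z) - emb (?f w))"
    by simp
  ultimately show ?thesis
    using norm_triangle_ineq[of "(z - emb (?f z)) - (w - emb (?f w))" "emb (?f z) - emb (?f w)"]
    by (simp add: dist_norm)
qed

text \<open>The isodiametric inequality for the union of the cells, whose diameter exceeds that of
  the lattice set by at most 2.\<close>

lemma card_le_of_diameter:
  assumes "finite E" "0 \<le> d" and d: "\<And>p q. p \<in> E \<Longrightarrow> q \<in> E \<Longrightarrow> dist (emb p) (emb q) \<le> d"
  shows "real (card E) \<le> pi / 4 * (d + 2)\<^sup>2"
proof -
  have "emeasure lborel (cells E) \<le> ennreal (pi / 4 * (d + 2)\<^sup>2)"
  proof (rule isodiametric[OF cells_borel[OF \<open>finite E\<close>]])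
    fix z w assume "z \<in> cells E" "w \<in> cells E"
    then show "dist z w \<le> d + 2"
      using dist_emb_floor_le[of z w] d[of "(\<lfloor>fst z\<rfloor>, \<lfloor>snd z\<rfloor>)" "(\<lfloor>fst w\<rfloor>, \<lfloor>snd w\<rfloor>)"]
      by (simp add: cells_def)
  qed (use assms in simp)
  then have "ennreal (real (card E)) \<le> ennreal (pi / 4 * (d + 2)\<^sup>2)"
    by (simp add: emeasure_cells[OF \<open>finite E\<close>] ennreal_of_nat_eq_real_of_nat)
  then show ?thesis by (subst (asm) ennreal_le_iff) auto
qed

definition lattice_disc :: "real \<Rightarrow> (int \<times> int) set" where
  "lattice_disc l = {p. norm (emb p) \<le> l}"

lemma finite_lattice_disc: "finite (lattice_disc l)"
proof (rule finite_subset)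
  show "lattice_disc l \<subseteq> {- \<lceil>l\<rceil>..\<lceil>l\<rceil>} \<times> {- \<lceil>l\<rceil>..\<lceil>l\<rceil>}"
  proof
    fix p assume "p \<in> lattice_disc l"
    then have "\<bar>real_of_int (fst p)\<bar> \<le> l" "\<bar>real_of_int (snd p)\<bar> \<le> l"
      using norm_fst_le[of "real_of_int (fst p)" "real_of_int (snd p)"]
        norm_snd_le[of "real_of_int (snd p)" "real_of_int (fst p)"]
      by (auto simp: lattice_disc_def emb_def)
    then show "p \<in> {- \<lceil>l\<rceil>..\<lceil>l\<rceil>} \<times> {- \<lceil>l\<rceil>..\<lceil>l\<rceil>}"
      by (cases p) (auto; linarith)
  qed
qed simp

text \<open>The cells at lattice points of norm at most \<open>l + 2\<close> cover the disc of
  radius \<open>l\<close>.\<close>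

lemma card_lattice_disc_ge:
  assumes "0 \<le> l"
  shows "pi * l\<^sup>2 \<le> real (card (lattice_disc (l + 2)))"
proof -
  have "cball 0 l \<subseteq> cells (lattice_disc (l + 2))"
  proof
    fix z :: "real \<times> real" assume "z \<in> cball 0 l"
    let ?p = "emb (\<lfloor>fst z\<rfloor>, \<lfloor>snd z\<rfloor>)"
    have "norm (?p - z) \<le> 2"
      by (rule norm_le_2_of_coordinates_le_1; simp add: emb_def; linarith)
    then have "norm ?p \<le> l + 2"
      using norm_triangle_sub[of ?p z] \<open>z \<in> cball 0 l\<close> by simp
    then show "z \<in> cells (lattice_disc (l + 2))" by (simp add: cells_def lattice_disc_def)
  qed
  then have "emeasure lborel (cball (0 :: real \<times> real) l) \<le> emeasure lborel (cells (lattice_disc (l + 2)))"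
    by (intro emeasure_mono) (auto intro: cells_borel finite_lattice_disc)
  then have "ennreal (pi * l\<^sup>2) \<le> ennreal (real (card (lattice_disc (l + 2))))"
    using emeasure_cball[OF \<open>0 \<le> l\<close>, of "0 :: real \<times> real"]
    by (simp add: emeasure_cells finite_lattice_disc ennreal_of_nat_eq_real_of_nat unit_ball_vol_2
        ennreal_mult' power2_eq_square)
  then show ?thesis by (subst (asm) ennreal_le_iff) auto
qed

section \<open>Second moment of the dot counts and the quadratic inequality\<close>

text \<open>The second moment of the number of points of \<open>D\<close> in \<open>z - B\<close> is bounded because an
  off-diagonal triple \<open>(z, a, b)\<close> is determined by \<open>(z - a, z - b)\<close>.\<close>

lemma distinct_differences_second_moment:
  fixes D B :: "'a :: ab_group_add set"
  assumes "finite D" "finite B"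
    and inj: "inj_on (\<lambda>(a, b). a - b) {(a, b). a \<in> D \<and> b \<in> D \<and> a \<noteq> b}"
  defines "E \<equiv> (\<lambda>(a, b). a + b) ` (D \<times> B)"
  shows "(card D * card B)\<^sup>2 \<le> card E * ((card B)\<^sup>2 + card D * card B)"
proof -
  have "finite E" using assms by simp
  define f where "f z = card {a \<in> D. z - a \<in> B}" for z
  \<comment> \<open>Double counting: a pair \<open>(z, a)\<close> corresponds to the pair
    \<open>(a, z - a)\<close> in \<open>D \<times> B\<close>.\<close>
  have first: "(\<Sum>z\<in>E. f z) = card D * card B"
  proof -
    have "(\<Sum>z\<in>E. f z) = card (SIGMA z:E. {a \<in> D. z - a \<in> B})"
      using \<open>finite E\<close> \<open>finite D\<close> by (simp add: f_def)
    also have "\<dots> = card (D \<times> B)"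
      by (rule bij_betw_same_card[of "\<lambda>(z, a). (a, z - a)"],
          rule bij_betw_byWitness[where f' = "\<lambda>(a, b). (a + b, a)"])
        (force simp: E_def)+
    finally show ?thesis by (simp add: card_cartesian_product)
  qed
  have second: "(\<Sum>z\<in>E. (f z)\<^sup>2) \<le> (card B)\<^sup>2 + card D * card B"
  proof -
    \<comment> \<open>Squaring \<open>f z\<close> counts ordered pairs of dots; \<open>T1\<close> is
      the off-diagonal part and \<open>T2\<close> the diagonal part.\<close>
    define T where "T = (SIGMA z:E. {a \<in> D. z - a \<in> B} \<times> {a \<in> D. z - a \<in> B})"
    define T1 where "T1 = {t \<in> T. fst (snd t) \<noteq> snd (snd t)}"
    define T2 where "T2 = {t \<in> T. fst (snd t) = snd (snd t)}"
    have fin: "finite T" using \<open>finite E\<close> \<open>finite D\<close> by (auto simp: T_def)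
    have "(\<Sum>z\<in>E. (f z)\<^sup>2) = card T"
      using \<open>finite E\<close> \<open>finite D\<close> by (simp add: f_def T_def card_cartesian_product power2_eq_square)
    also have "\<dots> = card T1 + card T2"
      using fin by (subst card_Un_disjoint[symmetric]) (auto simp: T1_def T2_def intro!: arg_cong[where f = card])
    also have "card T1 \<le> card (B \<times> B)"
    proof (rule card_inj_on_le[where f = "\<lambda>(z, a, b). (z - a, z - b)"])
      show "inj_on (\<lambda>(z, a, b). (z - a, z - b)) T1"
      proof (rule inj_onI, simp only: split_paired_all split_conv prod.inject)
        fix z a b z' a' b'
        assume t: "(z, a, b) \<in> T1" "(z', a', b') \<in> T1" and e: "z - a = z' - a' \<and> z - b = z' - b'"
        \<comment> \<open>Subtracting the coordinates of the image recovers \<open>a - b\<close>,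
          which fixes \<open>(a, b)\<close> by \<open>inj\<close>, and then
          \<open>z\<close>.\<close>
        have "a - b = a' - b'" using e by (metis diff_diff_eq2 diff_add_cancel add_diff_cancel_left')
        then have "a = a' \<and> b = b'"
          using t inj_onD[OF inj, of "(a, b)" "(a', b')"] by (auto simp: T1_def T_def)
        then show "z = z' \<and> a = a' \<and> b = b'" using e by auto
      qed
    qed (use \<open>finite B\<close> in \<open>auto simp: T1_def T_def\<close>)
    also have "card T2 \<le> card (D \<times> B)"
      by (rule card_inj_on_le[where f = "\<lambda>(z, a, b). (a, z - a)"])
        (use \<open>finite D\<close> \<open>finite B\<close> in \<open>auto simp: T2_def T_def inj_on_def\<close>)
    finally show ?thesis by (simp add: card_cartesian_product power2_eq_square)
  qed
  have "(\<Sum>z\<in>E. real (f z))\<^sup>2 \<le> real (card E) * (\<Sum>z\<in>E. (real (f z))\<^sup>2)"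
    using Cauchy_Schwarz_ineq_sum[of "\<lambda>_. 1" "\<lambda>z. real (f z)" E] by simp
  then have "real ((\<Sum>z\<in>E. f z)\<^sup>2) \<le> real (card E * (\<Sum>z\<in>E. (f z)\<^sup>2))" by simp
  then have "(\<Sum>z\<in>E. f z)\<^sup>2 \<le> card E * (\<Sum>z\<in>E. (f z)\<^sup>2)" by (simp only: of_nat_le_iff)
  also have "\<dots> \<le> card E * ((card B)\<^sup>2 + card D * card B)" using second by simp
  finally show ?thesis by (simp only: first)
qed

text \<open>The second moment bound for the lattice disc of radius \<open>l + 2\<close>: the
  enlarged radius gives \<open>B\<close> at least \<open>pi * l\<^sup>2\<close> points, and
  \<open>P\<^sup>2\<close> bounds the number of centres.\<close>

lemma DD_quadratic_bound:
  assumes DD: "is_DD m r D" and "0 < l"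
  defines "P \<equiv> sqrt pi / 2 * (real r + 2 * l + 6)"
  shows "(real m)\<^sup>2 \<le> P\<^sup>2 * (1 + real m / (pi * l\<^sup>2))"
proof -
  have D: "finite D" "card D = m" "\<And>a b. a \<in> D \<Longrightarrow> b \<in> D \<Longrightarrow> dist (emb a) (emb b) \<le> real r"
    and inj: "inj_on (\<lambda>(a, b). a - b) {(a, b). a \<in> D \<and> b \<in> D \<and> a \<noteq> b}"
    using DD unfolding is_DD_iff_differences by (auto simp: seg_length_def)
  define B where "B = lattice_disc (l + 2)"
  define E where "E = (\<lambda>(a, b). a + b) ` (D \<times> B)"
  define N where "N = real (card B)"
  have "finite B" by (simp add: B_def finite_lattice_disc)
  have N: "pi * l\<^sup>2 \<le> N" using card_lattice_disc_ge[of l] \<open>0 < l\<close> by (simp add: N_def B_def)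
  moreover have "0 < pi * l\<^sup>2" using \<open>0 < l\<close> by simp
  ultimately have "0 < N" by linarith
  have E: "real (card E) \<le> P\<^sup>2"
  proof -
    \<comment> \<open>The 4 comes from the diameter \<open>2 * (l + 2)\<close> of the disc, the
      further 2 from passing to cells; together they give the 6 in \<open>P\<close>.\<close>
    have "real (card E) \<le> pi / 4 * ((real r + 2 * l + 4) + 2)\<^sup>2"
    proof (rule card_le_of_diameter)
      show "finite E" using \<open>finite D\<close> \<open>finite B\<close> by (simp add: E_def)
      show "0 \<le> real r + 2 * l + 4" using \<open>0 < l\<close> by simp
      fix p q assume "p \<in> E" "q \<in> E"
      then obtain a b a' b' where *: "p = a + b" "q = a' + b'" "a \<in> D" "a' \<in> D" "b \<in> B" "b' \<in> B"
        by (auto simp: E_def)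
      have "emb p = emb a + emb b" "emb q = emb a' + emb b'" by (simp_all add: * emb_def)
      then have "dist (emb p) (emb q) \<le> dist (emb a) (emb a') + dist (emb b) (emb b')"
        by (simp add: dist_triangle_add)
      also have "dist (emb b) (emb b') \<le> norm (emb b) + norm (emb b')"
        by (simp add: dist_norm norm_triangle_ineq4)
      finally show "dist (emb p) (emb q) \<le> real r + 2 * l + 4"
        using D(3)[OF *(3,4)] *(5,6) by (simp add: B_def lattice_disc_def)
    qed
    also have "\<dots> = P\<^sup>2" by (simp add: P_def power_mult_distrib power_divide add_ac)
    finally show ?thesis .
  qed
  have "(real m * N)\<^sup>2 \<le> real (card E) * (N\<^sup>2 + real m * N)"
    using distinct_differences_second_moment[OF D(1) \<open>finite B\<close> inj, folded E_def]
    unfolding D(2) N_def by (simp flip: of_nat_mult of_nat_power of_nat_add)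
  also have "\<dots> \<le> P\<^sup>2 * (N\<^sup>2 + real m * N)"
    using E \<open>0 < N\<close> by (intro mult_right_mono) auto
  also have "\<dots> = P\<^sup>2 * (1 + real m / N) * N\<^sup>2"
    using \<open>0 < N\<close> by (simp add: field_simps power2_eq_square)
  finally have "(real m)\<^sup>2 \<le> P\<^sup>2 * (1 + real m / N)"
    using \<open>0 < N\<close> by (simp add: power_mult_distrib)
  also have "\<dots> \<le> P\<^sup>2 * (1 + real m / (pi * l\<^sup>2))"
    using N \<open>0 < pi * l\<^sup>2\<close> by (intro mult_left_mono add_left_mono divide_left_mono) auto
  finally show ?thesis .
qed

section \<open>Solving the quadratic inequality and expanding in powers of the cube root of
  \<open>r\<close>\<close>

text \<open>Completing the square gives \<open>P * sqrt (1 + (P * e / 2)\<^sup>2)\<close> as the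
  bound for \<open>x - P\<^sup>2 * e / 2\<close>; then
  \<open>sqrt (1 + s) \<le> 1 + s / 2\<close>.\<close>

lemma quadratic_root_bound:
  fixes x P e :: real
  assumes "x\<^sup>2 \<le> P\<^sup>2 * (1 + x * e)" "0 < P" "0 \<le> e"
  shows "x \<le> P + P\<^sup>2 * e / 2 + P ^ 3 * e\<^sup>2 / 8"
proof -
  have "(x - P\<^sup>2 * e / 2)\<^sup>2 \<le> P\<^sup>2 + (P\<^sup>2 * e / 2)\<^sup>2"
    using assms(1) by (simp add: power2_eq_square algebra_simps)
  \<comment> \<open>The added term is what makes the right side a perfect square.\<close>
  also have "\<dots> \<le> P\<^sup>2 + (P\<^sup>2 * e / 2)\<^sup>2 + (P ^ 3 * e\<^sup>2 / 8)\<^sup>2" by simp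
  also have "\<dots> = (P + P ^ 3 * e\<^sup>2 / 8)\<^sup>2"
    by (simp add: power2_eq_square power3_eq_cube algebra_simps)
  finally have "x - P\<^sup>2 * e / 2 \<le> P + P ^ 3 * e\<^sup>2 / 8"
    by (rule power2_le_imp_le) (use assms in simp)
  then show ?thesis by simp
qed

theorem theorem8:
  "\<exists>C::real. \<forall>(r::nat) (m::nat). r > 0 \<longrightarrow> (\<exists>D. is_DD m r D) \<longrightarrow>
     real m \<le> sqrt pi / 2 * real r
       + 3 * pi powr (1/3) / 2 powr (5/3) * real r powr (2/3)
       + C * real r powr (1/3)"
proof -
  \<comment> \<open>\<open>l = k r powr (2/3)\<close> minimises \<open>2 l + r\<^sup>2 / (4 \<surd>\<pi> l\<^sup>2)\<close>.\<close>
  define k :: real where "k = 2 powr (- 2/3) * pi powr (- 1/6)"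
  \<comment> \<open>\<open>g\<close> absorbs the lower terms of \<open>P\<close> once
    \<open>t \<ge> 1\<close>. In \<open>C\<close>, the summand \<open>3 * sqrt pi\<close> comes from
    the 6 in \<open>P\<close>, \<open>C1\<close> from the term \<open>P\<^sup>2 * e / 2\<close>, and
    \<open>C2\<close> from \<open>P ^ 3 * e\<^sup>2 / 8\<close>.\<close>
  define g where "g = 2 * k + 6"
  define C1 where "C1 = (2 * g + g\<^sup>2) / (8 * k\<^sup>2)"
  define C2 where "C2 = (sqrt pi / 2) ^ 3 * (1 + g) ^ 3 / (8 * (pi * k\<^sup>2)\<^sup>2)"
  define C where "C = 3 * sqrt pi + C1 + C2"
  have "0 < k" by (simp add: k_def)
  then have "0 < g" by (simp add: g_def)
  have spi: "sqrt pi = pi powr (1/2)" by (simp add: powr_half_sqrt)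
  \<comment> \<open>This is the vanishing of the derivative of
    \<open>2 * k + 1 / (4 * sqrt pi * k\<^sup>2)\<close>.\<close>
  have k3: "4 * sqrt pi * k ^ 3 = 1"
  proof -
    have "k ^ 3 = 2 powr (- 2) * pi powr (- 1/2)"
      by (simp add: k_def power_mult_distrib powr_power)
    also have "\<dots> = 1 / (4 * sqrt pi)"
      by (simp add: spi powr_minus field_simps)
    finally show ?thesis by simp
  qed
  then have k2: "1 / (8 * k\<^sup>2) = sqrt pi * k / 2"
    using \<open>0 < k\<close> by (simp add: field_simps power2_eq_square power3_eq_cube)
  \<comment> \<open>Of the factor \<open>3 / 2\<close>, the part 1 comes from \<open>P\<close> and,
    by \<open>k2\<close>, the part \<open>1 / 2\<close> from
    \<open>P\<^sup>2 * e / 2\<close>.\<close>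
  have coeff: "3 * pi powr (1/3) / 2 powr (5/3) = 3 / 2 * (sqrt pi * k)"
  proof -
    have "sqrt pi * k = 2 powr (- 2/3) * pi powr (1/3)"
      by (simp add: spi k_def flip: powr_add)
    moreover have "(2 :: real) powr (5/3) = 2 / 2 powr (- 2/3)"
      using powr_diff[of 2 1 "- 2/3 :: real"] by simp
    ultimately show ?thesis by simp
  qed
  have "real m \<le> sqrt pi / 2 * real r + 3 * pi powr (1/3) / 2 powr (5/3) * real r powr (2/3)
      + C * real r powr (1/3)" if "0 < r" and DD: "is_DD m r D" for r m D
  proof -
    \<comment> \<open>In terms of \<open>t\<close> all estimates become polynomial, and
      \<open>t \<ge> 1\<close> lets lower powers be absorbed.\<close>
    define t where "t = real r powr (1/3)"
    have t: "1 \<le> t" using \<open>0 < r\<close> by (simp add: t_def ge_one_powr_ge_zero)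
    have r: "real r = t ^ 3" "real r powr (2/3) = t\<^sup>2"
      using \<open>0 < r\<close> by (simp_all add: t_def powr_power)
    define P where "P = sqrt pi / 2 * (t ^ 3 + 2 * (k * t\<^sup>2) + 6)"
    define e where "e = 1 / (pi * (k * t\<^sup>2)\<^sup>2)"
    have "0 < P" "0 \<le> e" using \<open>0 < k\<close> t by (simp_all add: P_def e_def add_pos_pos)
    have "(real m)\<^sup>2 \<le> P\<^sup>2 * (1 + real m * e)"
      using DD_quadratic_bound[OF DD, of "k * t\<^sup>2"] \<open>0 < k\<close> t by (simp add: P_def e_def r)
    then have m: "real m \<le> P + P\<^sup>2 * e / 2 + P ^ 3 * e\<^sup>2 / 8"
      using \<open>0 < P\<close> \<open>0 \<le> e\<close> by (rule quadratic_root_bound)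
    have "1 \<le> t\<^sup>2" using t by simp
    then have P': "P \<le> sqrt pi / 2 * (t\<^sup>2 * (t + g))"
      unfolding P_def
      by (intro mult_left_mono) (auto simp: g_def algebra_simps power2_eq_square power3_eq_cube)
    have "P \<le> sqrt pi / 2 * t ^ 3 + sqrt pi * k * t\<^sup>2 + 3 * sqrt pi * t"
      using t by (simp add: P_def algebra_simps)
    moreover have "P\<^sup>2 * e / 2 \<le> sqrt pi * k / 2 * t\<^sup>2 + C1 * t"
    proof -
      have "P\<^sup>2 * e / 2 \<le> (sqrt pi / 2 * (t\<^sup>2 * (t + g)))\<^sup>2 * e / 2"
        using P' \<open>0 < P\<close> \<open>0 \<le> e\<close> by (intro divide_right_mono mult_right_mono power_mono) auto
      also have "\<dots> = 1 / (8 * k\<^sup>2) * (t + g)\<^sup>2"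
        using \<open>0 < k\<close> t by (simp add: e_def power_mult_distrib power_divide)
      \<comment> \<open>Only the constant \<open>g\<^sup>2\<close> is enlarged, to
        \<open>g\<^sup>2 * t\<close>; the main term stays exact.\<close>
      also have "\<dots> \<le> 1 / (8 * k\<^sup>2) * (t\<^sup>2 + (2 * g + g\<^sup>2) * t)"
        using t \<open>0 < g\<close> mult_left_mono[OF t, of "g\<^sup>2"]
        by (intro mult_left_mono) (auto simp: power2_sum algebra_simps)
      also have "\<dots> = 1 / (8 * k\<^sup>2) * t\<^sup>2 + C1 * t"
        by (simp add: C1_def distrib_left)
      finally show ?thesis by (simp only: k2)
    qed
    \<comment> \<open>Here \<open>P ^ 3\<close> has order \<open>t ^ 9\<close> and
      \<open>e\<^sup>2\<close> has order \<open>1 / t ^ 8\<close>, so a crude bound on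
      \<open>P\<close> suffices.\<close>
    moreover have "P ^ 3 * e\<^sup>2 / 8 \<le> C2 * t"
    proof -
      have "g \<le> g * t" using t \<open>0 < g\<close> by simp
      then have "sqrt pi / 2 * (t\<^sup>2 * (t + g)) \<le> sqrt pi / 2 * (t\<^sup>2 * ((1 + g) * t))"
        using t by (intro mult_left_mono) (auto simp: algebra_simps)
      then have "P \<le> sqrt pi / 2 * (1 + g) * t ^ 3"
        using P' by (simp add: power2_eq_square power3_eq_cube algebra_simps)
      then have "P ^ 3 * e\<^sup>2 / 8 \<le> (sqrt pi / 2 * (1 + g) * t ^ 3) ^ 3 * e\<^sup>2 / 8"
        using \<open>0 < P\<close> by (intro divide_right_mono mult_right_mono power_mono) auto
      also have "\<dots> = (sqrt pi / 2 * (1 + g)) ^ 3 * (t ^ 9 / (8 * (pi * k\<^sup>2)\<^sup>2 * t ^ 8))"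
        by (simp add: e_def power_mult_distrib power_divide mult_ac flip: power_mult)
      also have "t ^ 9 / (8 * (pi * k\<^sup>2)\<^sup>2 * t ^ 8) = t / (8 * (pi * k\<^sup>2)\<^sup>2)"
        using t power_add[of t 1 8] by simp
      finally show ?thesis
        by (simp only: C2_def power_mult_distrib times_divide_eq_left times_divide_eq_right power_divide)
    qed
    ultimately have "real m \<le> sqrt pi / 2 * t ^ 3 + 3 / 2 * (sqrt pi * k) * t\<^sup>2 + C * t"
      using m by (simp add: C_def algebra_simps)
    then show ?thesis
      unfolding coeff r(2) t_def[symmetric] by (simp only: r(1))
  qed
  then show ?thesis by blast
qed

end
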